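(* Let $G$ be a locally compact abelian group and let $\mu$ be a weakly almost periodic measure on $G$ with Eberlein decomposition $\mu=\mu_{\mathsf{s}}+\mu_0$. Then $\mu_{\mathsf{s}}\in\mathbb{X}(\mu)$. In particular, $\mathbb{X}(\mu_{\mathsf{s}})\subset\mathbb{X}(\mu)$.
   Context: $C_c(G)$: continuous compactly supported functions on $G$; $C_u(G)$: Banach space of bounded uniformly continuous complex functions, sup norm. $\theta_G$ (also $dt$) is Haar measure. Measures are (complex) Radon measures on $G$; the vague topology is the weak-* topology of the duality with $C_c(G)$. $\mu$ is translation bounded if $\sup_{x\in G}|\mu|(x+K)<\infty$ for all compact $K$ ($|\mu|$ the variation). $(c*\mu)(x)=\int_G c(x-t)\,d\mu(t)$; $T^tf(x)=f(x-t)$, $T^t\mu=\delta_t*\mu$. The hull $\mathbb{X}(\mu)$ is the vague closure of $\{T^t\mu:t\in G\}$. $f\in C_u(G)$ is Bohr (resp. weakly) almost periodic if $\{T^tf:t\in G\}$ is precompact in the norm (resp. weak) topology of $C_u(G)$. $G$ is assumed to admit Følner sequences: sequences $(A_n)$ of compact sets of positive measure with $\theta_G(A_n\triangle(x+A_n))/\theta_G(A_n)\to0$ for all $x\in G$. Every weakly almost periodic $f$ has a mean $M(f)=\lim_n\frac1{\theta_G(A_n)}\int_{x+A_n}f(t)\,dt$, uniformly in $x\in G$, independent of the Følner sequence; $f$ is null weakly almost periodic if moreover $M(|f|)=0$. A translation bounded measure $\mu$ is strongly, weakly, resp. null weakly almost periodic ($\mu\in\mathcal{SAP}(G)$, $\mathcal{WAP}(G)$,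 $\mathcal{WAP}_0(G)$) if for all $c\in C_c(G)$ the function $c*\mu$ is Bohr, weakly, resp. null weakly almost periodic. One has $\mathcal{WAP}(G)=\mathcal{SAP}(G)\oplus\mathcal{WAP}_0(G)$; the Eberlein decomposition of $\mu\in\mathcal{WAP}(G)$ is the unique decomposition $\mu=\mu_{\mathsf{s}}+\mu_0$ with $\mu_{\mathsf{s}}\in\mathcal{SAP}(G)$, $\mu_0\in\mathcal{WAP}_0(G)$. *)

theory Defs
  imports "HOL-Analysis.Analysis"
begin

section \<open>Function spaces on a topological abelian group\<close>

definition transl :: "'a::group_add \<Rightarrow> ('a \<Rightarrow> 'b) \<Rightarrow> 'a \<Rightarrow> 'b" where
  "transl t f = (\<lambda>x. f (x - t))"

definition supp :: "('a::topological_space \<Rightarrow> complex) \<Rightarrow> 'a set" where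
  "supp f = closure {x. f x \<noteq> 0}"

definition Cc :: "('a::topological_space \<Rightarrow> complex) set" where
  "Cc = {f. continuous_on UNIV f \<and> compact (supp f)}"

definition sup_norm :: "('a \<Rightarrow> complex) \<Rightarrow> real" where
  "sup_norm f = (SUP x. cmod (f x))"

text \<open>Uniform continuity refers to the group uniformity, given by the neighbourhoods of \<open>0\<close>.\<close>

definition Cu :: "('a::topological_ab_group_add \<Rightarrow> complex) set" where
  "Cu = {f. bounded (range f) \<and>
            (\<forall>e>0. \<forall>\<^sub>F h in nhds 0. \<forall>x. cmod (f (x + h) - f x) < e)}"

text \<open>\<open>Met_TC.fdist UNIV\<close> is the uniform distance of bounded functions; on \<open>Cu\<close> it is
  the distance of the sup norm, see \<open>fdist_Cu\<close> below.\<close>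

definition Cu_norm_topology :: "('a::topological_ab_group_add \<Rightarrow> complex) topology" where
  "Cu_norm_topology = Metric_space.mtopology Cu (Met_TC.fdist UNIV)"

definition Cu_dual :: "(('a::topological_ab_group_add \<Rightarrow> complex) \<Rightarrow> complex) set" where
  "Cu_dual = {\<phi> \<in> extensional Cu.
     (\<forall>f\<in>Cu. \<forall>g\<in>Cu. \<phi> (\<lambda>x. f x + g x) = \<phi> f + \<phi> g) \<and>
     (\<forall>a. \<forall>f\<in>Cu. \<phi> (\<lambda>x. a * f x) = a * \<phi> f) \<and>
     (\<exists>C. \<forall>f\<in>Cu. cmod (\<phi> f) \<le> C * sup_norm f)}"

definition Cu_weak_topology :: "('a::topological_ab_group_add \<Rightarrow> complex) topology" where
  "Cu_weak_topology =
     pullback_topology Cu (\<lambda>f. \<lambda>\<phi>\<in>Cu_dual. \<phi> f) (product_topology (\<lambda>_. euclidean) Cu_dual)"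

definition relatively_compact_in :: "'b topology \<Rightarrow> 'b set \<Rightarrow> bool" where
  "relatively_compact_in X S \<longleftrightarrow> S \<subseteq> topspace X \<and> compactin X (X closure_of S)"

definition bohr_ap :: "('a::topological_ab_group_add \<Rightarrow> complex) \<Rightarrow> bool" where
  "bohr_ap f \<longleftrightarrow> f \<in> Cu \<and> relatively_compact_in Cu_norm_topology (range (\<lambda>t. transl t f))"

definition weakly_ap :: "('a::topological_ab_group_add \<Rightarrow> complex) \<Rightarrow> bool" where
  "weakly_ap f \<longleftrightarrow> f \<in> Cu \<and> relatively_compact_in Cu_weak_topology (range (\<lambda>t. transl t f))"


section \<open>Haar measure, Folner sequences and means\<close>

definition haar_measure :: "'a::topological_ab_group_add measure \<Rightarrow> bool" where
  "haar_measure \<theta> \<longleftrightarrow>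
     sets \<theta> = sets borel \<and> emeasure \<theta> UNIV \<noteq> 0 \<and>
     (\<forall>K. compact K \<longrightarrow> emeasure \<theta> K < \<infinity>) \<and>
     (\<forall>A\<in>sets borel. emeasure \<theta> A = (INF U\<in>{U. open U \<and> A \<subseteq> U}. emeasure \<theta> U)) \<and>
     (\<forall>U. open U \<longrightarrow> emeasure \<theta> U = (SUP K\<in>{K. compact K \<and> K \<subseteq> U}. emeasure \<theta> K)) \<and>
     (\<forall>x. \<forall>A\<in>sets borel. emeasure \<theta> ((+) x ` A) = emeasure \<theta> A)"

definition folner_sequence ::
  "'a::topological_ab_group_add measure \<Rightarrow> (nat \<Rightarrow> 'a set) \<Rightarrow> bool" where
  "folner_sequence \<theta> A \<longleftrightarrow>
     (\<forall>n. compact (A n) \<and> 0 < measure \<theta> (A n)) \<and>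
     (\<forall>x. (\<lambda>n. measure \<theta> (sym_diff (A n) ((+) x ` A n)) / measure \<theta> (A n)) \<longlonglongrightarrow> 0)"

text \<open>For weakly almost periodic \<open>f\<close> the mean is a limit that is uniform in the translation and
  independent of the Folner sequence; \<open>has_mean \<theta> f m\<close> says that this limit is \<open>m\<close>.\<close>

definition has_mean ::
  "'a::topological_ab_group_add measure \<Rightarrow> ('a \<Rightarrow> 'b::{banach, second_countable_topology}) \<Rightarrow>
   'b \<Rightarrow> bool" where
  "has_mean \<theta> f m \<longleftrightarrow>
     (\<forall>A. folner_sequence \<theta> A \<longrightarrow>
        uniform_limit UNIV
          (\<lambda>n x. (1 / measure \<theta> (A n)) *\<^sub>R (LINT t : (+) x ` A n | \<theta>. f t)) (\<lambda>_. m) sequentially)"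

definition null_weakly_ap ::
  "'a::topological_ab_group_add measure \<Rightarrow> ('a \<Rightarrow> complex) \<Rightarrow> bool" where
  "null_weakly_ap \<theta> f \<longleftrightarrow> weakly_ap f \<and> has_mean \<theta> (\<lambda>t. cmod (f t)) 0"


section \<open>Complex Radon measures\<close>

text \<open>A complex Radon measure is a linear functional on \<open>Cc\<close> that is continuous for the
  inductive limit topology. As an element of a function space it is made \<open>extensional\<close>, so that
  equality of measures is equality on \<open>Cc\<close>.\<close>

definition radon_measures :: "(('a::topological_space \<Rightarrow> complex) \<Rightarrow> complex) set" where
  "radon_measures = {\<mu> \<in> extensional Cc.
     (\<forall>f\<in>Cc. \<forall>g\<in>Cc. \<mu> (\<lambda>x. f x + g x) = \<mu> f + \<mu> g) \<and>
     (\<forall>a. \<forall>f\<in>Cc. \<mu> (\<lambda>x. a * f x) = a * \<mu> f) \<and>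
     (\<forall>K. compact K \<longrightarrow> (\<exists>C. \<forall>f\<in>Cc. supp f \<subseteq> K \<longrightarrow> cmod (\<mu> f) \<le> C * sup_norm f))}"

definition vague_topology :: "(('a::topological_space \<Rightarrow> complex) \<Rightarrow> complex) topology" where
  "vague_topology = subtopology (product_topology (\<lambda>_. euclidean) Cc) radon_measures"

text \<open>The variation \<open>\<bar>\<mu>\<bar>\<close> as a set function, by the Riesz construction: on open sets it is the
  supremum of \<open>\<bar>\<mu>(g)\<bar>\<close> over \<open>\<bar>g\<bar> \<le> 1\<close> supported in the set, and it is outer regular.\<close>

definition variation ::
  "(('a::topological_space \<Rightarrow> complex) \<Rightarrow> complex) \<Rightarrow> 'a set \<Rightarrow> ennreal" where
  "variation \<mu> S =
     (INF U\<in>{U. open U \<and> S \<subseteq> U}.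
        SUP g\<in>{g \<in> Cc. supp g \<subseteq> U \<and> (\<forall>x. cmod (g x) \<le> 1)}. ennreal (cmod (\<mu> g)))"

definition translation_bounded ::
  "(('a::topological_ab_group_add \<Rightarrow> complex) \<Rightarrow> complex) \<Rightarrow> bool" where
  "translation_bounded \<mu> \<longleftrightarrow>
     \<mu> \<in> radon_measures \<and> (\<forall>K. compact K \<longrightarrow> (SUP x. variation \<mu> ((+) x ` K)) < \<infinity>)"

definition conv :: "('a::topological_ab_group_add \<Rightarrow> complex) \<Rightarrow>
    (('a \<Rightarrow> complex) \<Rightarrow> complex) \<Rightarrow> 'a \<Rightarrow> complex" where
  "conv c \<mu> = (\<lambda>x. \<mu> (\<lambda>t. c (x - t)))"

text \<open>\<open>(\<delta>\<^sub>t * \<mu>)(f) = \<integral> f(t + s) d\<mu>(s)\<close>.\<close>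

definition transl_measure :: "'a::topological_ab_group_add \<Rightarrow>
    (('a \<Rightarrow> complex) \<Rightarrow> complex) \<Rightarrow> (('a \<Rightarrow> complex) \<Rightarrow> complex)" where
  "transl_measure t \<mu> = (\<lambda>f\<in>Cc. \<mu> (\<lambda>s. f (t + s)))"

definition measure_hull :: "(('a::topological_ab_group_add \<Rightarrow> complex) \<Rightarrow> complex) \<Rightarrow>
    (('a \<Rightarrow> complex) \<Rightarrow> complex) set" where
  "measure_hull \<mu> = vague_topology closure_of (range (\<lambda>t. transl_measure t \<mu>))"

definition SAP :: "(('a::topological_ab_group_add \<Rightarrow> complex) \<Rightarrow> complex) set" where
  "SAP = {\<mu>. translation_bounded \<mu> \<and> (\<forall>c\<in>Cc. bohr_ap (conv c \<mu>))}"

definition WAP :: "(('a::topological_ab_group_add \<Rightarrow> complex) \<Rightarrow> complex) set" where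
  "WAP = {\<mu>. translation_bounded \<mu> \<and> (\<forall>c\<in>Cc. weakly_ap (conv c \<mu>))}"

definition WAP0 :: "'a::topological_ab_group_add measure \<Rightarrow>
    (('a \<Rightarrow> complex) \<Rightarrow> complex) set" where
  "WAP0 \<theta> = {\<mu>. translation_bounded \<mu> \<and> (\<forall>c\<in>Cc. null_weakly_ap \<theta> (conv c \<mu>))}"

definition eberlein_decomposition :: "'a::topological_ab_group_add measure \<Rightarrow>
    (('a \<Rightarrow> complex) \<Rightarrow> complex) \<Rightarrow> (('a \<Rightarrow> complex) \<Rightarrow> complex) \<Rightarrow>
    (('a \<Rightarrow> complex) \<Rightarrow> complex) \<Rightarrow> bool" where
  "eberlein_decomposition \<theta> \<mu> \<mu>\<^sub>s \<mu>\<^sub>0 \<longleftrightarrow>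
     \<mu>\<^sub>s \<in> SAP \<and> \<mu>\<^sub>0 \<in> WAP0 \<theta> \<and> \<mu> = (\<lambda>f\<in>Cc. \<mu>\<^sub>s f + \<mu>\<^sub>0 f)"


section \<open>The topologies are the intended ones\<close>

lemma Cu_subset_fspace: "Cu \<subseteq> Met_TC.fspace UNIV"
  by (auto simp: Cu_def Met_TC.fspace_def)

lemma fdist_Cu:
  assumes "f \<in> Cu" "g \<in> Cu"
  shows "Met_TC.fdist UNIV f g = sup_norm (\<lambda>x. f x - g x)"
  using assms Cu_subset_fspace by (auto simp: Met_TC.fdist_def sup_norm_def dist_norm)

lemma Metric_space_Cu:
  "Metric_space (Cu :: ('a::topological_ab_group_add \<Rightarrow> complex) set) (Met_TC.fdist UNIV)"
  using Metric_space.subspace[OF Met_TC.Metric_space_funspace Cu_subset_fspace] .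

lemma topspace_Cu_norm_topology: "topspace Cu_norm_topology = Cu"
  unfolding Cu_norm_topology_def
  by (rule Metric_space.topspace_mtopology[OF Metric_space_Cu])

lemma topspace_Cu_weak_topology: "topspace Cu_weak_topology = Cu"
  by (auto simp: Cu_weak_topology_def topspace_pullback_topology)

lemma topspace_vague_topology: "topspace vague_topology = radon_measures"
  by (auto simp: vague_topology_def radon_measures_def PiE_def)

end

theory Submission
  imports Defs
begin

text \<open>
  The value of \<open>T\<^sup>t \<mu>\<close> at \<open>f\<close> is \<open>g(-t) + h(-t)\<close>, where \<open>g\<close> is Bohr almost periodic, \<open>h\<close> is
  null weakly almost periodic and \<open>g(0) = \<mu>\<^sub>s(f)\<close>. For finitely many \<open>f\<close> and \<open>\<epsilon> > 0\<close> the set \<open>P\<close> of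
  common \<open>\<epsilon>\<close>-almost periods of the functions \<open>g\<close> has finitely many translates covering the group.
  If the sum of the functions \<open>\<bar>h\<bar>\<close> were bounded away from \<open>0\<close> on \<open>P\<close>, a finite sum of its
  translates would be bounded away from \<open>0\<close> everywhere, although its mean vanishes.
\<close>

section \<open>Almost periods of Bohr almost periodic functions\<close>

lemma cmod_le_fdist_Cu:
  assumes "f \<in> Cu" "g \<in> Cu"
  shows "cmod (f x - g x) \<le> Met_TC.fdist UNIV f g"
proof -
  have "bounded (range f)" "bounded (range g)"
    using assms by (auto simp: Cu_def)
  then have "bounded (range (\<lambda>x. f x - g x))"
    by (rule bounded_minus_comp)
  then have "bdd_above (range (\<lambda>x. cmod (f x - g x)))"
    by (intro bounded_imp_bdd_above) (simp add: bounded_norm_comp)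
  then have "cmod (f x - g x) \<le> sup_norm (\<lambda>x. f x - g x)"
    unfolding sup_norm_def by (rule cSUP_upper[OF UNIV_I])
  then show ?thesis
    by (simp add: fdist_Cu assms)
qed

text \<open>Relative compactness gives total boundedness, whose finitely many centres lie in the
  orbit itself. In terms of almost periods, \<open>t - s\<close> is an \<epsilon>-almost period of
  \<open>g\<close>, so finitely many translates of the set of these cover the group.\<close>

lemma bohr_ap_finite_net:
  assumes "bohr_ap g" "\<epsilon> > 0"
  shows "\<exists>T. finite T \<and> (\<forall>t. \<exists>s\<in>T. \<forall>x. cmod (g (x - t) - g (x - s)) < \<epsilon>)"
proof -
  interpret M: Metric_space Cu "Met_TC.fdist UNIV :: ('a \<Rightarrow> complex) \<Rightarrow> _"
    by (rule Metric_space_Cu)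
  let ?R = "range (\<lambda>t. transl t g)"
  have R: "?R \<subseteq> Cu" "compactin M.mtopology (M.mtopology closure_of ?R)"
    using assms(1) topspace_Cu_norm_topology
    unfolding bohr_ap_def relatively_compact_in_def Cu_norm_topology_def by auto
  have "M.mtotally_bounded ?R"
    by (rule M.mtotally_bounded_subset[OF M.compactin_imp_mtotally_bounded[OF R(2)] closure_of_subset])
      (simp add: R(1))
  then obtain K where K: "finite K" "K \<subseteq> ?R" "?R \<subseteq> (\<Union>k\<in>K. M.mball k \<epsilon>)"
    using assms(2) unfolding M.mtotally_bounded_def by meson
  obtain T where T: "finite T" "K = (\<lambda>t. transl t g) ` T"
    using finite_subset_image[OF K(1,2)] by blast
  have "\<exists>s\<in>T. \<forall>x. cmod (g (x - t) - g (x - s)) < \<epsilon>" for t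
  proof -
    obtain s where s: "s \<in> T" "Met_TC.fdist UNIV (transl s g) (transl t g) < \<epsilon>"
      using K(3) T(2) by (auto simp: subset_iff)
    have "cmod (g (x - t) - g (x - s)) < \<epsilon>" for x
    proof -
      have "transl s g \<in> Cu" "transl t g \<in> Cu"
        using R(1) by auto
      from cmod_le_fdist_Cu[OF this, of x] show ?thesis
        using s(2) by (simp add: transl_def norm_minus_commute)
    qed
    then show ?thesis using s(1) by blast
  qed
  then show ?thesis using T(1) by blast
qed

text \<open>Colour \<open>t\<close> by the tuple of its chosen \<epsilon>/2-centres, one in
  \<open>T g\<close> for each \<open>g\<close>. Only finitely many colours occur, and one
  representative of each colour forms the common net.\<close>

lemma bohr_ap_finite_common_net:
  assumes "finite S" "\<And>g. g \<in> S \<Longrightarrow> bohr_ap g" "\<epsilon> > 0"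
  shows "\<exists>T. finite T \<and> (\<forall>t. \<exists>s\<in>T. \<forall>g\<in>S. \<forall>x. cmod (g (x - t) - g (x - s)) < \<epsilon>)"
proof -
  have "\<exists>T. finite T \<and> (\<forall>t. \<exists>s\<in>T. \<forall>x. cmod (g (x - t) - g (x - s)) < \<epsilon> / 2)" if "g \<in> S" for g
    using bohr_ap_finite_net[OF assms(2)[OF that], of "\<epsilon> / 2"] assms(3) by simp
  then obtain T where T: "\<And>g. g \<in> S \<Longrightarrow> finite (T g)"
    "\<And>g t. g \<in> S \<Longrightarrow> \<exists>s\<in>T g. \<forall>x. cmod (g (x - t) - g (x - s)) < \<epsilon> / 2"
    by metis
  then obtain \<phi> where \<phi>: "\<And>g t. g \<in> S \<Longrightarrow> \<phi> g t \<in> T g"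
    "\<And>g t x. g \<in> S \<Longrightarrow> cmod (g (x - t) - g (x - \<phi> g t)) < \<epsilon> / 2"
    by metis
  define \<Phi> where "\<Phi> t = (\<lambda>g\<in>S. \<phi> g t)" for t
  have "range \<Phi> \<subseteq> PiE S T"
    using \<phi>(1) by (auto simp: \<Phi>_def)
  then have "finite (range \<Phi>)"
    using finite_PiE[OF assms(1)] T(1) finite_subset by meson
  then obtain R where R: "finite R" "range \<Phi> = \<Phi> ` R"
    using finite_subset_image[of "range \<Phi>" \<Phi> UNIV] by auto
  have "\<exists>s\<in>R. \<forall>g\<in>S. \<forall>x. cmod (g (x - t) - g (x - s)) < \<epsilon>" for t
  proof -
    obtain s where s: "s \<in> R" "\<Phi> t = \<Phi> s"
      using R(2) by (metis imageE rangeI)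
    have "cmod (g (x - t) - g (x - s)) < \<epsilon>" if "g \<in> S" for g x
    proof -
      \<comment> \<open>Equal colours mean a shared centre, so two errors below \<epsilon>/2 add up
        to less than \<epsilon>.\<close>
      have "\<phi> g t = \<phi> g s"
        using fun_cong[OF s(2), of g] that by (simp add: \<Phi>_def)
      then show ?thesis
        using \<phi>(2)[OF that, of x t] \<phi>(2)[OF that, of x s]
          norm_diff_triangle_less[of "g (x - t)" "g (x - \<phi> g t)" "\<epsilon> / 2" "g (x - s)" "\<epsilon> / 2"]
        by (simp add: norm_minus_commute)
    qed
    then show ?thesis using s(1) by blast
  qed
  then show ?thesis using R(1) by blast
qed

section \<open>Functions of mean zero\<close>

lemma Cu_imp_continuous:
  assumes "f \<in> Cu"
  shows "continuous_on UNIV f"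
proof -
  have "(f \<longlongrightarrow> f x) (nhds x)" for x
  proof (rule tendstoI)
    fix e :: real assume "e > 0"
    then have "\<forall>\<^sub>F h in nhds 0. \<forall>x. cmod (f (x + h) - f x) < e"
      using assms by (auto simp: Cu_def)
    moreover have "((\<lambda>y. y - x) \<longlongrightarrow> 0) (nhds x)"
      using tendsto_diff[OF filterlim_ident tendsto_const, of x x] by simp
    ultimately have "\<forall>\<^sub>F y in nhds x. \<forall>z. cmod (f (z + (y - x)) - f z) < e"
      by (rule eventually_compose_filterlim)
    then show "\<forall>\<^sub>F y in nhds x. dist (f y) (f x) < e"
      by (rule eventually_mono) (auto simp: dist_norm dest: spec[of _ x])
  qed
  then show ?thesis
    by (auto simp: continuous_on_def intro: filterlim_mono[OF _ order_refl at_within_le_nhds])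
qed

text \<open>By invariance \<open>\<theta>\<close> is its own image measure under translations, so a
  change of variables applies. It turns the averages over translated sets in \<open>has_mean\<close>
  into averages of translated functions over a fixed set.\<close>

lemma haar_set_integral_translate:
  fixes f :: "'a::topological_ab_group_add \<Rightarrow> 'b::{banach, second_countable_topology}"
  assumes "haar_measure \<theta>" "f \<in> borel_measurable borel" "A \<in> sets borel"
  shows "(LINT t : (+) x ` A | \<theta>. f t) = (LINT t : A | \<theta>. f (x + t))"
proof -
  have sets: "sets \<theta> = sets borel"
    and inv: "\<And>x A. A \<in> sets borel \<Longrightarrow> emeasure \<theta> ((+) x ` A) = emeasure \<theta> A"
    using assms(1) by (auto simp: haar_measure_def)
  have vimage: "(+) x -` B = (+) (- x) ` B" for x :: 'a and B
    by (auto intro: rev_image_eqI)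
  have meas: "(+) x \<in> measurable borel borel" for x :: 'a
    by (intro borel_measurable_continuous_onI continuous_intros)
  then have meas\<theta>: "(+) x \<in> measurable \<theta> \<theta>" for x
    by (simp add: measurable_cong_sets[OF sets sets])
  have image: "(+) x ` A \<in> sets borel"
    using measurable_sets[OF meas[of "-x"] assms(3)] by (simp add: vimage)
  have distr: "distr \<theta> \<theta> ((+) x) = \<theta>"
  proof (rule measure_eqI)
    fix B assume "B \<in> sets (distr \<theta> \<theta> ((+) x))"
    then show "emeasure (distr \<theta> \<theta> ((+) x)) B = emeasure \<theta> B"
      using sets inv[of B "-x"] sets_eq_imp_space_eq[OF sets]
      by (simp add: emeasure_distr[OF meas\<theta>] vimage)
  qed simp
  have "(LINT t : (+) x ` A | \<theta>. f t)
      = integral\<^sup>L (distr \<theta> \<theta> ((+) x)) (\<lambda>t. indicator ((+) x ` A) t *\<^sub>R f t)"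
    by (simp add: set_lebesgue_integral_def distr)
  also have "\<dots> = (LINT t|\<theta>. indicator ((+) x ` A) (x + t) *\<^sub>R f (x + t))"
  proof (rule integral_distr[OF meas\<theta>])
    have "(\<lambda>t. indicator ((+) x ` A) t *\<^sub>R f t) \<in> borel_measurable borel"
      using image assms(2) by measurable
    then show "(\<lambda>t. indicator ((+) x ` A) t *\<^sub>R f t) \<in> borel_measurable \<theta>"
      by (simp add: measurable_cong_sets[OF sets refl])
  qed
  also have "(\<lambda>t. indicator ((+) x ` A) (x + t) *\<^sub>R f (x + t)) = (\<lambda>t. indicator A t *\<^sub>R f (x + t))"
    by (rule ext) (simp add: indicator_def image_iff)
  finally show ?thesis
    by (simp add: set_lebesgue_integral_def)
qed

text \<open>Each translate of \<open>cmod (h x)\<close> has averages tending to 0, hence so does the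
  finite sum; a function bounded below by \<epsilon> has averages of at least \<epsilon>.\<close>

lemma sum_translates_null_small:
  fixes \<theta> :: "'a::{topological_ab_group_add, t2_space} measure"
  assumes "haar_measure \<theta>" "folner_sequence \<theta> A"
    and "finite H" "\<And>h. h \<in> H \<Longrightarrow> null_weakly_ap \<theta> h" "finite T" "\<epsilon> > 0"
  shows "\<exists>x. (\<Sum>h\<in>H. \<Sum>t\<in>T. cmod (h (t + x))) < \<epsilon>"
proof (rule ccontr)
  define F where "F x = (\<Sum>h\<in>H. \<Sum>t\<in>T. cmod (h (t + x)))" for x
  assume "\<not> ?thesis"
  then have F_ge: "\<epsilon> \<le> F x" for x
    by (auto simp: F_def not_less)
  have sets: "sets \<theta> = sets borel" and finK: "\<And>K. compact K \<Longrightarrow> emeasure \<theta> K < \<infinity>"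
    using assms(1) by (auto simp: haar_measure_def)
  have A: "compact (A n)" "measure \<theta> (A n) > 0" for n
    using assms(2) by (auto simp: folner_sequence_def)
  have A_sets: "A n \<in> sets borel" for n
    by (intro borel_closed compact_imp_closed A)
  have H: "h \<in> Cu" if "h \<in> H" for h
    using assms(4)[OF that] by (auto simp: null_weakly_ap_def weakly_ap_def)
  have cont: "continuous_on UNIV (\<lambda>x. cmod (h (t + x)))" if "h \<in> H" for h t
    by (intro continuous_on_norm continuous_on_compose2[OF Cu_imp_continuous[OF H[OF that]]]
        continuous_intros) auto
  have int: "set_integrable \<theta> (A n) (\<lambda>x. cmod (h (t + x)))" if h: "h \<in> H" for h t n
  proof -
    obtain B where B: "\<And>x. cmod (h x) \<le> B"
      using H[OF h] by (auto simp: Cu_def bounded_iff)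
    have "(\<lambda>x. cmod (h (t + x))) \<in> borel_measurable borel"
      by (intro borel_measurable_continuous_onI cont h)
    then have "set_borel_measurable \<theta> (A n) (\<lambda>x. cmod (h (t + x)))"
      unfolding set_borel_measurable_def measurable_cong_sets[OF sets refl] using A_sets[of n]
      by (intro borel_measurable_scaleR borel_measurable_indicator)
    \<comment> \<open>A constant is an integrable majorant because the compact set
      \<open>A n\<close> has finite Haar measure.\<close>
    moreover have "set_integrable \<theta> (A n) (\<lambda>_. B)"
      using finK[OF A(1)] A_sets sets by (auto simp: set_integrable_def)
    ultimately show ?thesis
      using order_trans[OF B abs_ge_self]
      by - (rule set_integrable_bound[of \<theta> "A n" "\<lambda>_. B"], simp_all)
  qed
  have mean: "(\<lambda>n. (1 / measure \<theta> (A n)) *\<^sub>R (LINT x : A n | \<theta>. cmod (h (t + x)))) \<longlonglongrightarrow> 0"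
    if "h \<in> H" for h t
  proof -
    \<comment> \<open>The uniform limit is evaluated at the translate by \<open>t\<close>; the
      translation then moves from the set to the function.\<close>
    have "(\<lambda>n. (1 / measure \<theta> (A n)) *\<^sub>R (LINT x : (+) t ` A n | \<theta>. cmod (h x))) \<longlonglongrightarrow> 0"
      using assms(2) assms(4)[OF that]
      by (auto simp: null_weakly_ap_def has_mean_def intro: tendsto_uniform_limitI)
    moreover have "(\<lambda>x. cmod (h x)) \<in> borel_measurable borel"
      using cont[OF that, of 0] by (intro borel_measurable_continuous_onI) simp
    ultimately show ?thesis
      by (simp add: haar_set_integral_translate[OF assms(1) _ A_sets])
  qed
  have "(\<lambda>n. \<Sum>h\<in>H. \<Sum>t\<in>T. (1 / measure \<theta> (A n)) *\<^sub>R (LINT x : A n | \<theta>. cmod (h (t + x)))) \<longlonglongrightarrow> 0"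
    by (intro tendsto_null_sum mean)
  moreover have "\<epsilon> \<le> (\<Sum>h\<in>H. \<Sum>t\<in>T. (1 / measure \<theta> (A n)) *\<^sub>R (LINT x : A n | \<theta>. cmod (h (t + x))))" for n
  proof -
    \<comment> \<open>Monotonicity of the Bochner integral requires integrability on both
      sides.\<close>
    have intF: "set_integrable \<theta> (A n) F"
      using int unfolding F_def set_integrable_def scaleR_sum_right
      by (intro Bochner_Integration.integrable_sum)
    have "\<epsilon> * measure \<theta> (A n) = (LINT x : A n | \<theta>. \<epsilon>)"
      using finK[OF A(1), of n] A_sets sets by (simp add: set_integral_const less_top[symmetric])
    also have "\<dots> \<le> (LINT x : A n | \<theta>. F x)"
      using finK[OF A(1)] A_sets sets F_ge
      by (intro set_integral_mono intF) (auto simp: set_integrable_def)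
    also have "\<dots> = (\<Sum>h\<in>H. \<Sum>t\<in>T. LINT x : A n | \<theta>. cmod (h (t + x)))"
      using int unfolding F_def set_integrable_def set_lebesgue_integral_def scaleR_sum_right
      by (simp add: Bochner_Integration.integral_sum)
    finally show ?thesis
      using A(2)[of n] by (simp add: sum_distrib_left[symmetric] field_simps flip: sum_divide_distrib)
  qed
  ultimately have "\<epsilon> \<le> 0"
    by (intro LIMSEQ_le_const) auto
  then show False using assms(6) by simp
qed

section \<open>Translates of Radon measures\<close>

lemma supp_compose_subset:
  assumes "continuous_on UNIV h"
  shows "supp (\<lambda>x. f (h x)) \<subseteq> h -` supp f"
  unfolding supp_def
  by (rule closure_minimal) (use assms in \<open>auto intro: closed_vimage subsetD[OF closure_subset]\<close>)

text \<open>The new support is a closed subset of the compact image of \<open>supp f\<close> under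
  the inverse map, hence compact without any separation axiom.\<close>

lemma Cc_compose_homeomorphism:
  assumes "f \<in> Cc" "homeomorphism UNIV UNIV h k"
  shows "(\<lambda>x. f (h x)) \<in> Cc"
proof -
  have h: "continuous_on UNIV h" and k: "continuous_on UNIV k" and hk: "\<And>x. k (h x) = x"
    using assms(2) by (auto simp: homeomorphism_def)
  have "compact (k ` supp f)"
    using assms(1) k by (auto simp: Cc_def intro: compact_continuous_image continuous_on_subset)
  moreover have "supp (\<lambda>x. f (h x)) \<subseteq> k ` supp f"
    using supp_compose_subset[OF h, of f] hk by (metis image_eqI subsetI subsetD vimageE)
  moreover have "closed (supp (\<lambda>x. f (h x)))"
    by (simp add: supp_def)
  ultimately have "compact (supp (\<lambda>x. f (h x)))"
    by (metis compact_Int_closed inf.absorb_iff2)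
  then show ?thesis
    using assms(1) h by (auto simp: Cc_def intro: continuous_on_compose2)
qed

lemma Cc_translate:
  fixes f :: "'a::topological_ab_group_add \<Rightarrow> complex"
  assumes "f \<in> Cc"
  shows "(\<lambda>s. f (t + s)) \<in> Cc"
proof (rule Cc_compose_homeomorphism[OF assms])
  show "homeomorphism UNIV UNIV ((+) t) ((+) (- t))"
    by (rule homeomorphismI) (auto intro: continuous_intros)
qed

lemma Cc_reflect:
  fixes f :: "'a::topological_ab_group_add \<Rightarrow> complex"
  assumes "f \<in> Cc"
  shows "(\<lambda>s. f (- s)) \<in> Cc"
proof (rule Cc_compose_homeomorphism[OF assms])
  show "homeomorphism UNIV UNIV uminus (uminus :: 'a \<Rightarrow> 'a)"
    by (rule homeomorphismI) (auto intro: continuous_intros)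
qed

lemma Cc_add:
  assumes "f \<in> Cc" "g \<in> Cc"
  shows "(\<lambda>x. f x + g x) \<in> Cc"
proof -
  have "compact (supp f \<union> supp g)"
    using assms by (auto simp: Cc_def)
  moreover have "supp (\<lambda>x. f x + g x) \<subseteq> supp f \<union> supp g"
    unfolding supp_def closure_Un[symmetric] by (rule closure_mono) auto
  moreover have "closed (supp (\<lambda>x. f x + g x))"
    by (simp add: supp_def)
  ultimately have "compact (supp (\<lambda>x. f x + g x))"
    by (metis compact_Int_closed inf.absorb_iff2)
  then show ?thesis
    using assms by (auto simp: Cc_def intro: continuous_on_add)
qed

lemma Cc_scale:
  assumes "f \<in> Cc"
  shows "(\<lambda>x. a * f x) \<in> Cc"
proof (cases "a = 0")
  case False
  then show ?thesis
    using assms by (auto simp: Cc_def supp_def intro: continuous_on_mult_left)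
qed (simp add: Cc_def supp_def)

text \<open>Translating a test function preserves its sup norm and moves a support in
  \<open>K\<close> into \<open>-t + K\<close>, so the constant of \<open>\<mu>\<close> for that
  compact set serves for \<open>K\<close>.\<close>

lemma transl_measure_in_radon_measures:
  fixes \<mu> :: "('a::topological_ab_group_add \<Rightarrow> complex) \<Rightarrow> complex"
  assumes "\<mu> \<in> radon_measures"
  shows "transl_measure t \<mu> \<in> radon_measures"
proof -
  have add: "\<And>f g. f \<in> Cc \<Longrightarrow> g \<in> Cc \<Longrightarrow> \<mu> (\<lambda>x. f x + g x) = \<mu> f + \<mu> g"
    and scale: "\<And>a f. f \<in> Cc \<Longrightarrow> \<mu> (\<lambda>x. a * f x) = a * \<mu> f"
    and bound: "\<And>K. compact K \<Longrightarrow> \<exists>C. \<forall>f\<in>Cc. supp f \<subseteq> K \<longrightarrow> cmod (\<mu> f) \<le> C * sup_norm f"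
    using assms by (auto simp: radon_measures_def)
  have norm: "sup_norm (\<lambda>s. f (t + s)) = sup_norm f" for f :: "'a \<Rightarrow> complex"
    using image_image[of "\<lambda>s. cmod (f s)" "(+) t" UNIV] by (simp add: sup_norm_def)
  have "\<exists>C. \<forall>f\<in>Cc. supp f \<subseteq> K \<longrightarrow> cmod (transl_measure t \<mu> f) \<le> C * sup_norm f"
    if "compact K" for K
  proof -
    have "compact ((+) (- t) ` K)"
      by (intro compact_continuous_image continuous_intros that)
    then obtain C where C: "\<forall>f\<in>Cc. supp f \<subseteq> (+) (- t) ` K \<longrightarrow> cmod (\<mu> f) \<le> C * sup_norm f"
      using bound by blast
    have "cmod (transl_measure t \<mu> f) \<le> C * sup_norm f" if "f \<in> Cc" "supp f \<subseteq> K" for f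
    proof -
      have "supp (\<lambda>s. f (t + s)) \<subseteq> (+) t -` supp f"
        by (intro supp_compose_subset continuous_intros)
      also have "\<dots> \<subseteq> (+) (- t) ` K"
        using that(2) by (auto intro: rev_image_eqI)
      finally show ?thesis
        using C that(1) Cc_translate[OF that(1), of t] norm[of f]
        by (auto simp: transl_measure_def dest: bspec[of _ _ "\<lambda>s. f (t + s)"])
    qed
    then show ?thesis by blast
  qed
  then show ?thesis
    by (auto simp: radon_measures_def transl_measure_def add scale Cc_add Cc_scale Cc_translate)
qed

text \<open>Shifts the extra translation onto the test function, so that approximating a translate
  of \<open>\<mu>\<^sub>s\<close> reduces to approximating \<open>\<mu>\<^sub>s\<close>
  itself.\<close>

lemma transl_measure_transl_measure:
  assumes "f \<in> Cc"
  shows "transl_measure (s + t) \<mu> f = transl_measure t \<mu> (\<lambda>r. f (s + r))"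
  using assms Cc_translate[OF assms, of s] by (simp add: transl_measure_def add.assoc)

text \<open>A basic open set of the product topology restricts only finitely many coordinates, here
  the values at finitely many test functions.\<close>

lemma in_vague_closure:
  assumes "\<nu> \<in> radon_measures" "S \<subseteq> radon_measures"
    and approx: "\<And>F \<epsilon>. finite F \<Longrightarrow> F \<subseteq> Cc \<Longrightarrow> \<epsilon> > 0 \<Longrightarrow> \<exists>\<sigma>\<in>S. \<forall>f\<in>F. cmod (\<sigma> f - \<nu> f) < \<epsilon>"
  shows "\<nu> \<in> vague_topology closure_of S"
  unfolding in_closure_of
proof (intro conjI allI impI)
  show "\<nu> \<in> topspace vague_topology"
    using assms(1) by (simp add: topspace_vague_topology)
next
  fix V assume V: "\<nu> \<in> V \<and> openin vague_topology V"
  then obtain W where W: "openin (product_topology (\<lambda>_. euclidean) Cc) W" "V = W \<inter> radon_measures"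
    unfolding vague_topology_def openin_subtopology by blast
  obtain U where U: "finite {f \<in> Cc. U f \<noteq> UNIV}" "\<And>f. f \<in> Cc \<Longrightarrow> open (U f)"
    "\<nu> \<in> PiE Cc U" "PiE Cc U \<subseteq> W"
    using W V unfolding openin_product_topology_alt by auto
  let ?F = "{f \<in> Cc. U f \<noteq> UNIV}"
  have "\<exists>e>0. ball (\<nu> f) e \<subseteq> U f" if "f \<in> Cc" for f
    using U(2)[OF that] PiE_mem[OF U(3) that] by (auto simp: open_contains_ball)
  then obtain e where e: "\<And>f. f \<in> Cc \<Longrightarrow> e f > 0" "\<And>f. f \<in> Cc \<Longrightarrow> ball (\<nu> f) (e f) \<subseteq> U f"
    by metis
  \<comment> \<open>The inserted 1 keeps the minimum meaningful when no coordinate is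
    restricted.\<close>
  define \<epsilon> where "\<epsilon> = Min (insert 1 (e ` ?F))"
  have "\<epsilon> > 0"
    using U(1) e(1) by (auto simp: \<epsilon>_def)
  then obtain \<sigma> where \<sigma>: "\<sigma> \<in> S" "\<forall>f\<in>?F. cmod (\<sigma> f - \<nu> f) < \<epsilon>"
    using approx[OF U(1), of \<epsilon>] by auto
  have "\<sigma> f \<in> U f" if "f \<in> Cc" for f
  proof (cases "U f = UNIV")
    case False
    then have "\<epsilon> \<le> e f"
      using U(1) that by (auto simp: \<epsilon>_def intro!: Min_le)
    then have "\<sigma> f \<in> ball (\<nu> f) (e f)"
      using \<sigma>(2) that False by (force simp: dist_norm norm_minus_commute)
    then show ?thesis using e(2)[OF that] by blast
  qed simp
  moreover have "\<sigma> \<in> extensional Cc"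
    using \<sigma>(1) assms(2) by (auto simp: radon_measures_def)
  ultimately have "\<sigma> \<in> PiE Cc U"
    by (simp add: PiE_iff)
  then have "\<sigma> \<in> V"
    using U(4) W(2) \<sigma>(1) assms(2) by blast
  then show "\<exists>y. y \<in> S \<and> y \<in> V"
    using \<sigma>(1) by blast
qed

section \<open>The strongly almost periodic component\<close>

text \<open>The order of choices matters: first the net \<open>T\<close> for the Bohr parts, then a
  point \<open>x\<close> where the null parts are small at \<open>x - s\<close> for all
  \<open>s\<close> in \<open>T\<close> simultaneously, and only then the \<open>s\<close> for which
  \<open>x - s\<close> is a common almost period. The translation is by
  \<open>s - x\<close>.\<close>

lemma eberlein_decomposition_approx:
  fixes \<theta> :: "'a::{topological_ab_group_add, t2_space} measure"
  assumes "haar_measure \<theta>" "folner_sequence \<theta> A" "eberlein_decomposition \<theta> \<mu> \<mu>\<^sub>s \<mu>\<^sub>0"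
    and "finite F" "F \<subseteq> Cc" "\<epsilon> > 0"
  shows "\<exists>t. \<forall>f\<in>F. cmod (transl_measure t \<mu> f - \<mu>\<^sub>s f) < \<epsilon>"
proof -
  \<comment> \<open>Reflecting \<open>f\<close> makes the convolution at \<open>x\<close> equal to
    the value at \<open>f\<close> of the measure translated by \<open>-x\<close>; at 0 it is
    \<open>\<mu>\<^sub>s f\<close>.\<close>
  define g where "g f = conv (\<lambda>s. f (- s)) \<mu>\<^sub>s" for f
  define h where "h f = conv (\<lambda>s. f (- s)) \<mu>\<^sub>0" for f
  have dec: "\<mu>\<^sub>s \<in> SAP" "\<mu>\<^sub>0 \<in> WAP0 \<theta>" "\<mu> = (\<lambda>f\<in>Cc. \<mu>\<^sub>s f + \<mu>\<^sub>0 f)"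
    using assms(3) by (auto simp: eberlein_decomposition_def)
  have g: "bohr_ap (g f)" and h: "null_weakly_ap \<theta> (h f)" if "f \<in> F" for f
    using dec Cc_reflect[of f] assms(5) that by (auto simp: SAP_def WAP0_def g_def h_def)
  have split: "transl_measure t \<mu> f = g f (- t) + h f (- t)" "\<mu>\<^sub>s f = g f 0" if "f \<in> F" for f t
    using that assms(5) Cc_translate[of f t]
    by (auto simp: transl_measure_def g_def h_def conv_def dec(3) add.commute subset_iff)
  obtain T where T: "finite T"
    "\<And>t. \<exists>s\<in>T. \<forall>p\<in>g ` F. \<forall>x. cmod (p (x - t) - p (x - s)) < \<epsilon> / 2"
    using bohr_ap_finite_common_net[of "g ` F" "\<epsilon> / 2"] g assms(4,6) by auto
  obtain x where x: "(\<Sum>p\<in>h ` F. \<Sum>t\<in>uminus ` T. cmod (p (t + x))) < \<epsilon> / 2"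
    using sum_translates_null_small[OF assms(1,2), of "h ` F" "uminus ` T" "\<epsilon> / 2"]
      h assms(4,6) T(1) by auto
  obtain s where s: "s \<in> T" "\<And>f y. f \<in> F \<Longrightarrow> cmod (g f (y - x) - g f (y - s)) < \<epsilon> / 2"
    using T(2)[of x] by auto
  have "cmod (transl_measure (s - x) \<mu> f - \<mu>\<^sub>s f) < \<epsilon>" if f: "f \<in> F" for f
  proof -
    \<comment> \<open>A single nonnegative term is bounded by the double sum.\<close>
    have "cmod (h f (x - s)) \<le> (\<Sum>t\<in>uminus ` T. cmod (h f (t + x)))"
      using member_le_sum[of "- s" "uminus ` T" "\<lambda>t. cmod (h f (t + x))"] s(1) T(1) by auto
    also have "\<dots> \<le> (\<Sum>p\<in>h ` F. \<Sum>t\<in>uminus ` T. cmod (p (t + x)))"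
      using member_le_sum[of "h f" "h ` F" "\<lambda>p. \<Sum>t\<in>uminus ` T. cmod (p (t + x))"] f assms(4)
      by (simp add: sum_nonneg)
    finally have "cmod (h f (x - s)) < \<epsilon> / 2"
      using x by linarith
    \<comment> \<open>The net estimate is taken at \<open>y = x\<close>.\<close>
    moreover have "cmod (g f (x - s) - g f 0) < \<epsilon> / 2"
      using s(2)[OF f, of x] by (simp add: norm_minus_commute)
    moreover have "transl_measure (s - x) \<mu> f - \<mu>\<^sub>s f = (g f (x - s) - g f 0) + h f (x - s)"
      by (simp add: split[OF f])
    ultimately show ?thesis
      using norm_triangle_ineq[of "g f (x - s) - g f 0" "h f (x - s)"] by simp
  qed
  then show ?thesis by blast
qed

theorem theorem3p15:
  fixes \<theta> :: "'a::{topological_ab_group_add, t2_space} measure"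
    and \<mu> \<mu>\<^sub>s \<mu>\<^sub>0 :: "('a \<Rightarrow> complex) \<Rightarrow> complex"
  assumes "locally_compact_space (euclidean :: 'a topology)"
    and "haar_measure \<theta>"
    and "\<exists>A. folner_sequence \<theta> A"
    and "\<mu> \<in> WAP"
    and "eberlein_decomposition \<theta> \<mu> \<mu>\<^sub>s \<mu>\<^sub>0"
  shows "\<mu>\<^sub>s \<in> measure_hull \<mu> \<and> measure_hull \<mu>\<^sub>s \<subseteq> measure_hull \<mu>"
proof -
  obtain A where A: "folner_sequence \<theta> A"
    using assms(3) by blast
  have radon: "\<mu> \<in> radon_measures" "\<mu>\<^sub>s \<in> radon_measures"
    using assms(4,5) by (auto simp: WAP_def eberlein_decomposition_def SAP_def translation_bounded_def)
  \<comment> \<open>Treating all translates at once yields both claims: \<open>s = 0\<close> gives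
    membership, and the whole orbit gives the inclusion of hulls.\<close>
  have hull: "transl_measure s \<mu>\<^sub>s \<in> measure_hull \<mu>" for s
    unfolding measure_hull_def
  proof (rule in_vague_closure)
    fix F :: "('a \<Rightarrow> complex) set" and \<epsilon> :: real
    assume F: "finite F" "F \<subseteq> Cc" "\<epsilon> > 0"
    \<comment> \<open>Approximation on the test functions translated by \<open>s\<close> makes
      \<open>s + t\<close> the translation of \<open>\<mu>\<close> that works for
      \<open>F\<close>.\<close>
    obtain t where t: "\<forall>p\<in>(\<lambda>f r. f (s + r)) ` F. cmod (transl_measure t \<mu> p - \<mu>\<^sub>s p) < \<epsilon>"
      using eberlein_decomposition_approx[OF assms(2) A assms(5), of "(\<lambda>f r. f (s + r)) ` F" \<epsilon>]
        F Cc_translate by blast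
    have "cmod (transl_measure (s + t) \<mu> f - transl_measure s \<mu>\<^sub>s f) < \<epsilon>" if "f \<in> F" for f
      using t that F(2) by (auto simp: transl_measure_transl_measure subset_iff transl_measure_def[of s \<mu>\<^sub>s])
    then show "\<exists>\<sigma>\<in>range (\<lambda>t. transl_measure t \<mu>). \<forall>f\<in>F. cmod (\<sigma> f - transl_measure s \<mu>\<^sub>s f) < \<epsilon>"
      by blast
  qed (auto intro: transl_measure_in_radon_measures radon)
  \<comment> \<open>Extensionality of Radon measures makes the two agree outside \<open>Cc\<close>
    as well.\<close>
  have "transl_measure 0 \<mu>\<^sub>s = \<mu>\<^sub>s"
    using radon(2) by (auto simp: transl_measure_def radon_measures_def extensional_def)
  then have "\<mu>\<^sub>s \<in> measure_hull \<mu>"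
    using hull[of 0] by simp
  \<comment> \<open>The hull of \<open>\<mu>\<close> is closed and contains the orbit of
    \<open>\<mu>\<^sub>s\<close>, hence also its closure.\<close>
  moreover have "measure_hull \<mu>\<^sub>s \<subseteq> measure_hull \<mu>"
    using hull unfolding measure_hull_def[of \<mu>\<^sub>s]
    by (intro closure_of_minimal) (auto simp: measure_hull_def)
  ultimately show ?thesis by simp
qed

end
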